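(* Let $\underline{x}$ and $\bar{x}$ be the equilibrium disclosure thresholds defined in the context. 1. The elaborateness of reports, $\Pr(x<\underline{x})+\Pr(x>\bar{x})$, increases with the investor's competence $\beta$. That is, $\frac{\partial\bar{x}}{\partial\beta}<0$ and $\frac{\partial\underline{x}}{\partial\beta}>0$. 2. The firm's information environment $q$ has an ambiguous effect on the elaborateness of reports. (a) When $r<r_0$, the frequency of negative (positive) elaborate reports, $\Pr(x<\underline{x})$ ($\Pr(x>\bar{x})$), decreases (increases) with the firm's information environment: $\frac{\partial\bar{x}}{\partial q}<0$ and $\frac{\partial\underline{x}}{\partial q}<0$. (b) When $r>r_0$, the frequency of positive (negative) elaborate reports, $\Pr(x>\bar{x})$ ($\Pr(x<\underline{x})$), decreases (increases) with the firm's information environment: $\frac{\partial\bar{x}}{\partial q}>0$ and $\frac{\partial\underline{x}}{\partial q}>0$.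
   Context: A firm has value $\theta=rx$, where $r$ is a continuous variable on $\mathbb{R}^+$ with mean $r_0$, and $x$ is a continuous variable on $\mathbb{R}$ with density $g$, cdf $G$ and mean $\mu_0>0$, independent of $r$. An investor who knows $r$ always discloses it, and also knows $x$ (is *informed* ) with probability $\beta$, the investor's "competence". The investor takes a position in the stock at price $r_0\mu_0$ before disclosure and closes it afterwards. After the investor's disclosure, $\theta$ is revealed by other sources with probability $q$, the firm's "information environment". In the unique equilibrium, for each realization $r$, the informed investor withholds $x$ exactly when $x\in[\underline{x},\bar{x}]$, and otherwise issues an *elaborate* report disclosing both $r$ and $x$; the elaborate report is negative if $x<\underline{x}$ and positive if $x>\bar{x}$. A report disclosing only $r$ is *simple*. The elaborateness $\Pr(x<\underline{x})+\Pr(x>\bar{x})$ is the likelihood of an elaborate report conditional on the investor being informed about $x$. The thresholds are uniquely determined as follows. When $r<r_0$: $$\beta\int_{\underline{x}}^{\bar{x}}\bigl(G(x)-G(\bar{x})\bigr)dx-(1-\beta)(\mu_0-\underline{x})=0,\qquad (1+q)\bar{x}+(1-q)\underline{x}=\frac{2r_0\mu_0}{r}.$$ When $r>r_0$: $$\beta\int_{\underline{x}}^{\bar{x}}\bigl(G(x)-G(\underline{x})\bigr)dx-(1-\beta)(\mu_0-\bar{x})=0,\qquad (1-q)\bar{x}+(1+q)\underline{x}=\frac{2r_0\mu_0}{r}.$$ "Ambiguous effect" in item 2 means that the likelihoods of negative and of positive elaborate reports move in opposite directions as $q$ increases, so that the overall effect of $q$ on their sum is not determined in sign.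
   Formalization: The density g is assumed continuous and positive on all of ℝ, competence β lies strictly between 0 and 1, and q lies in [0,1) (one-sided derivative at q=0); without these, some of the stated derivatives vanish or fail to exist. *)

theory Defs
  imports "HOL-Probability.Probability"
begin

(* The firm value is R * X. The density of X is continuous and everywhere positive: X is a
   continuous variable whose support is the whole real line. Without positivity the strict
   inequalities fail: for r < r0 the lower threshold does not respond to q where g vanishes at
   the upper one, and symmetrically for r > r0. *)
locale disclosure_model = prob_space M
  for M :: "'a measure" +
  fixes R X :: "'a \<Rightarrow> real" and g :: "real \<Rightarrow> real"
  assumes R_continuous: "\<exists>f :: real \<Rightarrow> real. distributed M lborel R (\<lambda>t. ennreal (f t))"
    and R_positive: "AE \<omega> in M. 0 < R \<omega>"
    and R_integrable: "integrable M R"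
    and X_density: "distributed M lborel X (\<lambda>t. ennreal (g t))"
    and g_continuous: "continuous_on UNIV g"
    and g_positive: "\<And>t. 0 < g t"
    and X_integrable: "integrable M X"
    and X_mean_positive: "0 < expectation X"
    and independent: "indep_var borel R borel X"

(* G, \<mu>0: cdf and mean of X; r0: mean of R; r: realization of R. The interval [xl, xu] of
   withheld values is required to be ordered: with an oriented integral there may be spurious
   solutions with xu < xl. Nothing is prescribed for r = r0. For r < r0 the first equation says,
   after integration by parts, that xl is the mean of X given a simple report, and the second that
   the investor is indifferent at xu; for r > r0 the roles of xl and xu are exchanged. *)
definition threshold_system ::
  "(real \<Rightarrow> real) \<Rightarrow> real \<Rightarrow> real \<Rightarrow> real \<Rightarrow> real \<Rightarrow> real \<Rightarrow> real \<Rightarrow> real \<Rightarrow> bool" where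
  "threshold_system G \<mu>0 r0 r \<beta> q xl xu \<longleftrightarrow>
     xl \<le> xu \<and>
     (r < r0 \<longrightarrow>
        \<beta> * integral {xl..xu} (\<lambda>x. G x - G xu) - (1 - \<beta>) * (\<mu>0 - xl) = 0 \<and>
        (1 + q) * xu + (1 - q) * xl = 2 * r0 * \<mu>0 / r) \<and>
     (r0 < r \<longrightarrow>
        \<beta> * integral {xl..xu} (\<lambda>x. G x - G xl) - (1 - \<beta>) * (\<mu>0 - xu) = 0 \<and>
        (1 - q) * xu + (1 + q) * xl = 2 * r0 * \<mu>0 / r)"

definition thresholds ::
  "'a measure \<Rightarrow> ('a \<Rightarrow> real) \<Rightarrow> ('a \<Rightarrow> real) \<Rightarrow> real \<Rightarrow> real \<Rightarrow> real \<Rightarrow> real \<times> real" where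
  "thresholds M R X r \<beta> q =
     (THE p. threshold_system (cdf (distr M borel X)) (integral\<^sup>L M X) (integral\<^sup>L M R) r \<beta> q
               (fst p) (snd p))"

definition lower_threshold ::
  "'a measure \<Rightarrow> ('a \<Rightarrow> real) \<Rightarrow> ('a \<Rightarrow> real) \<Rightarrow> real \<Rightarrow> real \<Rightarrow> real \<Rightarrow> real" where
  "lower_threshold M R X r \<beta> q = fst (thresholds M R X r \<beta> q)"

definition upper_threshold ::
  "'a measure \<Rightarrow> ('a \<Rightarrow> real) \<Rightarrow> ('a \<Rightarrow> real) \<Rightarrow> real \<Rightarrow> real \<Rightarrow> real \<Rightarrow> real" where
  "upper_threshold M R X r \<beta> q = snd (thresholds M R X r \<beta> q)"

definition negative_frequency ::
  "'a measure \<Rightarrow> ('a \<Rightarrow> real) \<Rightarrow> ('a \<Rightarrow> real) \<Rightarrow> real \<Rightarrow> real \<Rightarrow> real \<Rightarrow> real" where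
  "negative_frequency M R X r \<beta> q = \<P>(\<omega> in M. X \<omega> < lower_threshold M R X r \<beta> q)"

definition positive_frequency ::
  "'a measure \<Rightarrow> ('a \<Rightarrow> real) \<Rightarrow> ('a \<Rightarrow> real) \<Rightarrow> real \<Rightarrow> real \<Rightarrow> real \<Rightarrow> real" where
  "positive_frequency M R X r \<beta> q = \<P>(\<omega> in M. upper_threshold M R X r \<beta> q < X \<omega>)"

definition elaborateness ::
  "'a measure \<Rightarrow> ('a \<Rightarrow> real) \<Rightarrow> ('a \<Rightarrow> real) \<Rightarrow> real \<Rightarrow> real \<Rightarrow> real \<Rightarrow> real" where
  "elaborateness M R X r \<beta> q = negative_frequency M R X r \<beta> q + positive_frequency M R X r \<beta> q"

(* The regime is (<) for r < r0 and (>) for r > r0. The elaborateness can respond to q with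
   derivative of sign s, for suitable admissible primitives. *)
definition q_effect_possible :: "(real \<Rightarrow> real \<Rightarrow> bool) \<Rightarrow> real \<Rightarrow> bool" where
  "q_effect_possible regime s \<longleftrightarrow>
     (\<exists>(M :: (real \<times> real) measure) R X g r \<beta> q d.
        disclosure_model M R X g \<and> 0 < r \<and> regime r (integral\<^sup>L M R) \<and>
        \<beta> \<in> {0<..<1} \<and> q \<in> {0..<1} \<and>
        (elaborateness M R X r \<beta> has_real_derivative d) (at q within {0..<1}) \<and> sgn d = s)"

end

theory Submission
  imports Defs
begin

text \<open>
  Put \<open>H(l,u) = loss l u = \<integral>\<^bsub>[l,u]\<^esub> (G(u) - G(x)) dx\<close>. For \<open>r < r0\<close> the thresholds solve
  \<open>(1 - \<beta>)(l - m) = \<beta> H(l,u)\<close> and \<open>(1 + q) u + (1 - q) l = T\<close> with \<open>2 m < T\<close>; the case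
  \<open>r > r0\<close> reduces to this one by \<open>x \<mapsto> - x\<close>. Since \<open>H\<close> increases in \<open>u\<close> and decreases in \<open>l\<close>, a
  solution exists and is unique with \<open>m < l < T/2 < u\<close>, and implicit differentiation gives the
  signs in \<open>\<beta>\<close> and \<open>q\<close>. The elaborateness changes with \<open>q\<close> by a positive multiple of
  \<open>1 - \<beta> + \<beta> (G(u) - G(l)) - \<beta> (u - l) g(l)\<close>. As any \<open>m < l < u\<close> is an equilibrium for some \<open>\<beta>\<close> and
  \<open>T\<close>, for every distribution of \<open>x\<close> this is made positive by \<open>l\<close> close to \<open>m\<close> and negative by
  \<open>u\<close> large.
\<close>

section \<open>Signs of derivatives and strict monotonicity\<close>

lemma deriv_neg_minus_iff:
  fixes f :: "real \<Rightarrow> real"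
  shows "(\<exists>D<0. ((\<lambda>x. - f x) has_real_derivative D) (at y within S)) \<longleftrightarrow>
    (\<exists>D>0. (f has_real_derivative D) (at y within S))"
proof
  assume "\<exists>D<0. ((\<lambda>x. - f x) has_real_derivative D) (at y within S)"
  then obtain D where "D < 0" "((\<lambda>x. - f x) has_real_derivative D) (at y within S)" by blast
  then have "0 < - D" "(f has_real_derivative - D) (at y within S)"
    using DERIV_minus[of "\<lambda>x. - f x" D] by simp_all
  then show "\<exists>D>0. (f has_real_derivative D) (at y within S)" by blast
next
  assume "\<exists>D>0. (f has_real_derivative D) (at y within S)"
  then obtain D where "0 < D" "(f has_real_derivative D) (at y within S)" by blast
  then have "- D < 0" "((\<lambda>x. - f x) has_real_derivative - D) (at y within S)"
    using DERIV_minus[of f D] by simp_all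
  then show "\<exists>D<0. ((\<lambda>x. - f x) has_real_derivative D) (at y within S)" by blast
qed

text \<open>Derivatives within \<open>S\<close> cover the half-open range of \<open>q\<close>, where
  only a one-sided derivative exists at 0. The mean value theorem is applied on a segment
  \<open>{a..b}\<close> contained in \<open>S\<close>.\<close>

lemma pos_deriv_imp_strict_mono_on:
  fixes f :: "real \<Rightarrow> real"
  assumes "is_interval S" and "\<And>t. t \<in> S \<Longrightarrow> \<exists>D>0. (f has_real_derivative D) (at t within S)"
  shows "strict_mono_on S f"
proof (rule strict_mono_onI)
  fix a b assume ab: "a \<in> S" "b \<in> S" "a < b"
  have sub: "{a..b} \<subseteq> S"
    using mem_is_interval_1_I[OF \<open>is_interval S\<close> ab(1,2)] by auto
  obtain f' where f': "\<And>t. t \<in> S \<Longrightarrow> 0 < f' t \<and> (f has_real_derivative f' t) (at t within S)"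
    using assms(2) by metis
  have "\<exists>x\<in>{a<..<b}. f b - f a = f' x * (b - a)"
  proof (rule mvt_simple[OF \<open>a < b\<close>])
    fix x assume "a \<le> x" "x \<le> b"
    then have "(f has_real_derivative f' x) (at x within {a..b})"
      using f' sub by (meson DERIV_subset atLeastAtMost_iff subsetD)
    then show "(f has_derivative (*) (f' x)) (at x within {a..b})"
      by (simp add: has_field_derivative_def)
  qed
  then obtain x where "x \<in> {a<..<b}" "f b - f a = f' x * (b - a)" by blast
  moreover have "x \<in> S" using sub \<open>x \<in> {a<..<b}\<close> by (intro subsetD[OF sub]) simp
  ultimately have "0 < f' x" "f b - f a = f' x * (b - a)" using f' by blast+
  then show "f a < f b"
    using \<open>a < b\<close> by (metis diff_gt_0_iff_gt mult_pos_pos)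
qed

lemma neg_deriv_imp_strict_antimono_on:
  fixes f :: "real \<Rightarrow> real"
  assumes "is_interval S" and "\<And>t. t \<in> S \<Longrightarrow> \<exists>D<0. (f has_real_derivative D) (at t within S)"
  shows "strict_antimono_on S f"
proof -
  have "strict_mono_on S (\<lambda>t. - f t)"
    by (rule pos_deriv_imp_strict_mono_on[OF assms(1)])
       (use assms(2) in \<open>simp flip: deriv_neg_minus_iff\<close>)
  then show ?thesis by (auto simp: monotone_on_def)
qed

subsection \<open>The reduced threshold system\<close>

locale withholding =
  fixes G K g :: "real \<Rightarrow> real" and m :: real
  assumes K_deriv: "\<And>x. (K has_real_derivative G x) (at x)"
    and G_deriv: "\<And>x. (G has_real_derivative g x) (at x)"
    and g_pos: "\<And>x. 0 < g x"
begin

text \<open>Expressing the integral through the antiderivative \<open>K\<close> keeps integration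
  out of the locale and makes the derivative in \<open>u\<close> elementary.\<close>

definition loss :: "real \<Rightarrow> real \<Rightarrow> real" where
  "loss l u = (u - l) * G u - (K u - K l)"

definition equilibrium :: "real \<Rightarrow> real \<Rightarrow> real \<Rightarrow> real \<Rightarrow> real \<Rightarrow> bool" where
  "equilibrium T b q l u \<longleftrightarrow>
     l \<le> u \<and> (1 - b) * (l - m) = b * loss l u \<and> (1 + q) * u + (1 - q) * l = T"

lemma G_strict_mono: "x < y \<Longrightarrow> G x < G y"
  by (rule DERIV_pos_imp_increasing) (use G_deriv g_pos in auto)

lemma G_mono: "x \<le> y \<Longrightarrow> G x \<le> G y"
  using G_strict_mono[of x y] by (cases "x = y") auto

lemma K_increment:
  assumes "x < y"
  obtains z where "x < z" "z < y" "K y - K x = (y - x) * G z"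
  using MVT2[OF assms, of K G] K_deriv by blast

lemma loss_self [simp]: "loss x x = 0"
  by (simp add: loss_def)

lemma loss_pos:
  assumes "l < u"
  shows "0 < loss l u"
proof -
  obtain z where "l < z" "z < u" "K u - K l = (u - l) * G z"
    using K_increment[OF assms] .
  moreover have "G z < G u" using \<open>z < u\<close> by (rule G_strict_mono)
  ultimately show ?thesis using assms by (simp add: loss_def)
qed

lemma loss_deriv_upper: "((\<lambda>u. loss l u) has_real_derivative (u - l) * g u) (at u)"
  unfolding loss_def by (auto intro!: derivative_eq_intros K_deriv G_deriv)

lemma loss_mono_upper:
  assumes "l \<le> u" "u \<le> v"
  shows "loss l u \<le> loss l v"
proof (rule DERIV_nonneg_imp_nondecreasing[OF \<open>u \<le> v\<close>])
  fix x assume "u \<le> x"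
  then show "\<exists>y. ((\<lambda>u. loss l u) has_real_derivative y) (at x) \<and> 0 \<le> y"
    using \<open>l \<le> u\<close> g_pos[of x] by (intro exI[of _ "(x - l) * g x"] conjI loss_deriv_upper) auto
qed

text \<open>If \<open>l = u\<close>, the first equation gives \<open>l = m\<close> and the second
  \<open>2 * m = T\<close>, a contradiction; so \<open>loss l u\<close> is positive and
  \<open>l\<close> exceeds \<open>m\<close>. By the second equation \<open>T / 2\<close> is an
  average of \<open>u\<close> and \<open>l\<close> with positive weights \<open>(1 + q) / 2\<close>
  and \<open>(1 - q) / 2\<close>, hence strictly between them.\<close>

lemma equilibrium_bounds:
  assumes e: "equilibrium T b q l u" and T: "2 * m < T" and b: "0 < b" "b < 1" and q: "0 \<le> q" "q < 1"
  shows "m < l" "l < T / 2" "T / 2 < u"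
proof -
  have lu: "l \<le> u" and eq: "(1 - b) * (l - m) = b * loss l u"
    and lin: "(1 + q) * u + (1 - q) * l = T"
    using e by (auto simp: equilibrium_def)
  have "l \<noteq> u"
  proof
    assume "l = u"
    then have "l = m" using eq b by simp
    moreover have "2 * l = T" using lin \<open>l = u\<close> by (simp add: algebra_simps)
    ultimately show False using T by simp
  qed
  then have lu: "l < u" using lu by simp
  have "0 < (1 - b) * (l - m)" unfolding eq using loss_pos[OF lu] b by simp
  then show "m < l" using b by (simp add: zero_less_mult_iff)
  have "(1 + q) * l < (1 + q) * u" "(1 - q) * l < (1 - q) * u" using lu q by auto
  then show "l < T / 2" "T / 2 < u" using lin by (auto simp: algebra_simps)
qed

text \<open>The second equation gives \<open>u\<close> as a function of \<open>l\<close>. Along this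
  line the defect \<open>\<Phi>\<close> of the first equation is nonpositive at \<open>m\<close>,
  where only the loss remains, and nonnegative at \<open>T / 2\<close>, where \<open>u = l\<close>
  and the loss vanishes. The intermediate value theorem supplies a zero.\<close>

lemma equilibrium_exists:
  assumes T: "2 * m < T" and b: "0 < b" "b < 1" and q: "0 \<le> q" "q < 1"
  shows "\<exists>l u. equilibrium T b q l u"
proof -
  define u where "u l = (T - (1 - q) * l) / (1 + q)" for l
  define \<Phi> where "\<Phi> l = (1 - b) * (l - m) - b * loss l (u l)" for l
  have lin: "(1 + q) * u l + (1 - q) * l = T" for l
    using q by (simp add: u_def field_simps)
  have le: "l \<le> u l" if "l \<le> T / 2" for l
    using that q by (simp add: u_def field_simps)
  have "isCont G x" "isCont K x" for x
    using G_deriv K_deriv by (auto intro: DERIV_isCont)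
  then have GK: "continuous_on UNIV G" "continuous_on UNIV K"
    by (auto simp: continuous_on_eq_continuous_at)
  have cont: "continuous_on {m..T / 2} \<Phi>"
    unfolding \<Phi>_def loss_def u_def using q
    by (intro continuous_intros continuous_on_compose2[OF GK(1)] continuous_on_compose2[OF GK(2)]) auto
  have uT: "u (T / 2) = T / 2" using q by (simp add: u_def field_simps)
  have "m < u m" using le[of m] T q by (simp add: u_def field_simps)
  then have "\<Phi> m \<le> 0" using loss_pos b by (simp add: \<Phi>_def less_imp_le)
  moreover have "0 \<le> \<Phi> (T / 2)" using T b by (simp add: \<Phi>_def uT)
  ultimately obtain l where "m \<le> l" "l \<le> T / 2" "\<Phi> l = 0"
    using IVT'[OF _ _ _ cont] T by auto
  then have "equilibrium T b q l (u l)"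
    using le[of l] lin[of l] by (simp add: equilibrium_def \<Phi>_def)
  then show ?thesis by blast
qed

section \<open>Uniqueness and implicit differentiation\<close>

text \<open>The finite-increment form of implicit differentiation: \<open>s\<close> and \<open>k\<close> are the difference
  quotients of \<open>loss l\<close> and \<open>K\<close>. It yields uniqueness, continuity and the derivative at once.\<close>

lemma equilibrium_increment:
  assumes e: "equilibrium T \<beta> q l u" and e': "equilibrium T b p L U"
    and b: "0 < b"
    and s: "loss l U - loss l u = s * (U - u)" and k: "K L - K l = k * (L - l)"
  defines "A \<equiv> 1 - \<beta> + \<beta> * (G U - k)"
  shows "((1 + q) * A + (1 - q) * (\<beta> * s)) * (L - l) =
           (1 + q) * ((L - m) / b) * (b - \<beta>) - \<beta> * s * (U - L) * (p - q)"
proof -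
  have 1: "(1 + q) * (U - u) + (1 - q) * (L - l) + (p - q) * (U - L) = 0"
    using e e' by (simp add: equilibrium_def algebra_simps)
  have eq: "(1 - \<beta>) * (l - m) = \<beta> * loss l u" and eq': "(1 - b) * (L - m) = b * loss L U"
    using e e' by (auto simp: equilibrium_def)
  \<comment> \<open>The first equation at the second equilibrium, solved for what becomes the
    coefficient of \<open>b - \<beta>\<close>.\<close>
  have c: "(L - m) / b = L - m + loss L U"
    using eq' b by (simp add: field_simps)
  \<comment> \<open>The path goes from \<open>(l, u)\<close> to \<open>(l, U)\<close> and then to
    \<open>(L, U)\<close>; on the second leg the increment is exactly
    \<open>(k - G U) * (L - l)\<close>.\<close>
  have "loss L U - loss l u = s * (U - u) + (k - G U) * (L - l)"
    using s k by (simp add: loss_def algebra_simps)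
  then have 2: "A * (L - l) = (L - m) / b * (b - \<beta>) + \<beta> * s * (U - u)"
    unfolding c A_def using eq eq' by algebra
  \<comment> \<open>Multiply 2 by \<open>1 + q\<close> and eliminate \<open>U - u\<close> by means
    of 1.\<close>
  show ?thesis using 1 2 by algebra
qed

text \<open>\<open>s U\<close> is nonnegative because \<open>loss l\<close> is nondecreasing above
  \<open>l\<close>. \<open>k L\<close> is a value of \<open>G\<close> at a point between
  \<open>l\<close> and \<open>L\<close>, thus below \<open>T / 2\<close> and below \<open>U\<close>.
  At coinciding arguments the quotients are not determined by increments, and the assumed values at
  \<open>u\<close> and \<open>l\<close> take over.\<close>

lemma increment_coefficients:
  assumes l: "l < T / 2" "L < T / 2" and u: "T / 2 < u" "T / 2 < U"
    and s: "\<And>z. loss l z - loss l u = s z * (z - u)" "0 \<le> s u"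
    and k: "\<And>z. K z - K l = k z * (z - l)" "k l = G l"
  shows "0 \<le> s U" "k L \<le> G U"
proof -
  show "0 \<le> s U"
  proof (cases u U rule: linorder_cases)
    case equal
    then show ?thesis using s by simp
  next
    case less
    then have "0 \<le> s U * (U - u)" using loss_mono_upper[of l u U] s(1)[of U] l u by simp
    then show ?thesis using less by (simp add: zero_le_mult_iff)
  next
    case greater
    then have "s U * (U - u) \<le> 0" using loss_mono_upper[of l U u] s(1)[of U] l u by simp
    then show ?thesis using greater by (simp add: mult_le_0_iff)
  qed
  show "k L \<le> G U"
  proof (cases l L rule: linorder_cases)
    case equal
    then show ?thesis using k(2) G_mono[of l U] l u by simp
  next
    case less
    obtain z where "l < z" "z < L" "K L - K l = (L - l) * G z" using K_increment[OF less] .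
    then have "k L = G z" using k(1)[of L] less by simp
    then show ?thesis using G_mono[of z U] \<open>z < L\<close> l u by simp
  next
    case greater
    obtain z where z: "L < z" "z < l" "K l - K L = (l - L) * G z" using K_increment[OF greater] .
    then have "k L * (L - l) = G z * (L - l)" using k(1)[of L] by (simp add: algebra_simps)
    then have "k L = G z" using greater by simp
    then show ?thesis using G_mono[of z U] z l u by simp
  qed
qed

text \<open>Caratheodory's form of differentiability: the difference quotients, completed by the
  derivative, are continuous at the base point.\<close>

lemma slopes_exist:
  assumes "l \<le> u"
  shows "\<exists>s k. (\<forall>z. loss l z - loss l u = s z * (z - u)) \<and> isCont s u \<and> s u = (u - l) * g u \<and>
    (\<forall>z. K z - K l = k z * (z - l)) \<and> isCont k l \<and> k l = G l \<and> 0 \<le> s u"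
proof -
  obtain s where "\<forall>z. loss l z - loss l u = s z * (z - u)" "isCont s u" "s u = (u - l) * g u"
    using loss_deriv_upper[of l u] unfolding CARAT_DERIV by blast
  moreover obtain k where "\<forall>z. K z - K l = k z * (z - l)" "isCont k l" "k l = G l"
    using K_deriv[of l] unfolding CARAT_DERIV by blast
  moreover have "0 \<le> (u - l) * g u" using assms g_pos[of u] by simp
  ultimately show ?thesis by metis
qed

text \<open>With equal parameters the right-hand side of the increment identity vanishes, while the
  factor of \<open>L - l\<close> is positive.\<close>

lemma equilibrium_unique:
  assumes T: "2 * m < T" and b: "0 < b" "b < 1" and q: "0 \<le> q" "q < 1"
    and e: "equilibrium T b q l u" and e': "equilibrium T b q L U"
  shows "l = L \<and> u = U"
proof -
  note B = equilibrium_bounds[OF e T b q] and B' = equilibrium_bounds[OF e' T b q]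
  have "l \<le> u" using e by (simp add: equilibrium_def)
  from slopes_exist[OF this] obtain s k where sk: "\<And>z. loss l z - loss l u = s z * (z - u)" "isCont s u" "s u = (u - l) * g u"
    "\<And>z. K z - K l = k z * (z - l)" "isCont k l" "k l = G l" "0 \<le> s u"
    by blast
  have "0 \<le> s U" "k L \<le> G U"
    using increment_coefficients[OF B(2) B'(2) B(3) B'(3) sk(1,7,4,6)] .
  then have "0 < (1 + q) * (1 - b + b * (G U - k L)) + (1 - q) * (b * s U)"
    using b q by (intro add_pos_nonneg mult_pos_pos) auto
  then have "L = l" using equilibrium_increment[OF e e' b(1) sk(1) sk(4)] by simp
  then have "(1 + q) * u = (1 + q) * U" using e e' unfolding equilibrium_def by auto
  then show ?thesis using \<open>L = l\<close> q by simp
qed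

text \<open>Both parameters are functions of one variable \<open>t\<close>, so that the derivatives
  in competence and in environment are special cases. The increment identity first bounds
  \<open>\<bar>L t - L x\<bar>\<close>, which gives continuity of \<open>L\<close> and then of
  \<open>U\<close>; divided by \<open>t - x\<close> it then converges to the derivative.\<close>

lemma equilibrium_derivative:
  fixes \<beta> q L U :: "real \<Rightarrow> real"
  assumes T: "2 * m < T"
    and e: "\<And>t. t \<in> S \<Longrightarrow> equilibrium T (\<beta> t) (q t) (L t) (U t)"
    and \<beta>: "\<And>t. t \<in> S \<Longrightarrow> 0 < \<beta> t" "\<And>t. t \<in> S \<Longrightarrow> \<beta> t < 1"
    and q: "\<And>t. t \<in> S \<Longrightarrow> 0 \<le> q t" "\<And>t. t \<in> S \<Longrightarrow> q t < 1"
    and x: "x \<in> S"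
    and \<beta>': "(\<beta> has_real_derivative \<beta>') (at x within S)"
    and q': "(q has_real_derivative q') (at x within S)"
  defines "A \<equiv> 1 - \<beta> x + \<beta> x * (G (U x) - G (L x))"
    and "B \<equiv> \<beta> x * ((U x - L x) * g (U x))"
  defines "L' \<equiv> ((1 + q x) * ((L x - m) / \<beta> x) * \<beta>' - B * (U x - L x) * q')
                   / ((1 + q x) * A + (1 - q x) * B)"
  shows "(L has_real_derivative L') (at x within S)"
    and "(U has_real_derivative - (q' * (U x - L x) + (1 - q x) * L') / (1 + q x)) (at x within S)"
proof -
  let ?F = "at x within S"
  note bounds = equilibrium_bounds[OF e T \<beta> q]
  note \<beta>x = \<beta>[OF x] and qx = q[OF x]
  have lin: "(1 + q t) * U t + (1 - q t) * L t = T" if "t \<in> S" for t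
    using e[OF that] by (simp add: equilibrium_def)
  have "L x \<le> U x" using e[OF x] by (simp add: equilibrium_def)
  from slopes_exist[OF this] obtain s k where sk: "\<And>z. loss (L x) z - loss (L x) (U x) = s z * (z - U x)"
    "isCont s (U x)" "s (U x) = (U x - L x) * g (U x)"
    "\<And>z. K z - K (L x) = k z * (z - L x)" "isCont k (L x)" "k (L x) = G (L x)" "0 \<le> s (U x)"
    by blast
  define A' where "A' t = 1 - \<beta> x + \<beta> x * (G (U t) - k (L t))" for t
  define B' where "B' t = \<beta> x * s (U t)" for t
  define D where "D t = (1 + q x) * A' t + (1 - q x) * B' t" for t
  have inc: "D t * (L t - L x) =
      (1 + q x) * ((L t - m) / \<beta> t) * (\<beta> t - \<beta> x) - B' t * (U t - L t) * (q t - q x)"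
    if t: "t \<in> S" for t
    unfolding D_def A'_def B'_def
    by (rule equilibrium_increment[OF e[OF x] e[OF t] \<beta>(1)[OF t] sk(1) sk(4)])
  have coef: "0 \<le> s (U t)" "k (L t) \<le> G (U t)" if t: "t \<in> S" for t
    using increment_coefficients[OF bounds(2)[OF x x x x x] bounds(2)[OF t t t t t]
        bounds(3)[OF x x x x x] bounds(3)[OF t t t t t] sk(1,7,4,6)] .
  have B'_nn: "0 \<le> B' t" and A'_ge: "1 - \<beta> x \<le> A' t" if "t \<in> S" for t
    using coef[OF that] \<beta>x by (auto simp: A'_def B'_def)
  \<comment> \<open>The first bound serves the term in \<open>\<beta> t - \<beta> x\<close>. The
    second lets \<open>D t\<close> absorb the factor \<open>B' t\<close> in the other term, since
    the size of \<open>B' t\<close> is not controlled before \<open>U\<close> is known to be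
    continuous.\<close>
  have D_ge: "1 - \<beta> x \<le> D t" "(1 - q x) * B' t \<le> D t" if t: "t \<in> S" for t
  proof -
    have "1 * (1 - \<beta> x) \<le> (1 + q x) * A' t"
      using A'_ge[OF t] \<beta>x qx by (intro mult_mono) auto
    moreover have "0 \<le> (1 - q x) * B' t" using B'_nn[OF t] qx by simp
    ultimately show "1 - \<beta> x \<le> D t" "(1 - q x) * B' t \<le> D t" using \<beta>x by (auto simp: D_def)
  qed
  have \<beta>_lim: "(\<beta> \<longlongrightarrow> \<beta> x) ?F" and q_lim: "(q \<longlongrightarrow> q x) ?F"
    using DERIV_continuous[OF \<beta>'] DERIV_continuous[OF q'] by (auto simp: continuous_within)
  have ev: "\<forall>\<^sub>F t in ?F. t \<in> S" by (simp add: eventually_at_filter)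
  have L_lim: "(L \<longlongrightarrow> L x) ?F"
  proof -
    \<comment> \<open>\<open>C\<close> bounds \<open>L t - m\<close>, as \<open>L t < T / 2\<close>.
      \<open>W\<close> bounds \<open>U t - L t\<close>, as
      \<open>(1 + q t) * (U t - L t) = T - 2 * L t\<close> and \<open>m < L t\<close>.\<close>
    define C where "C = T / 2 - m"
    define W where "W = T - 2 * m"
    have bd: "\<bar>L t - L x\<bar> \<le> 2 * (C / \<beta> t) * \<bar>\<beta> t - \<beta> x\<bar> / (1 - \<beta> x) + W / (1 - q x) * \<bar>q t - q x\<bar>"
      if t: "t \<in> S" for t
    proof -
      note bt = bounds[OF t t t t t]
      have D: "0 < D t" using D_ge(1)[OF t] \<beta>x by simp
      have UL: "0 \<le> U t - L t" "U t - L t \<le> W"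
      proof -
        show "0 \<le> U t - L t" using bt by simp
        have "(1 + q t) * (U t - L t) = T - 2 * L t" using lin[OF t] by (simp add: algebra_simps)
        moreover have "1 * (U t - L t) \<le> (1 + q t) * (U t - L t)"
          using bt q[OF t] by (intro mult_right_mono) auto
        ultimately show "U t - L t \<le> W" using bt by (simp add: W_def)
      qed
      have c: "0 \<le> (L t - m) / \<beta> t" "(L t - m) / \<beta> t \<le> C / \<beta> t"
        using bt \<beta>[OF t] by (auto simp: C_def intro!: divide_right_mono)
      have "\<bar>L t - L x\<bar> * D t =
          \<bar>(1 + q x) * ((L t - m) / \<beta> t) * (\<beta> t - \<beta> x) - B' t * (U t - L t) * (q t - q x)\<bar>"
        using inc[OF t] D by (metis abs_mult abs_of_pos mult.commute)
      also have "\<dots> \<le> (1 + q x) * ((L t - m) / \<beta> t) * \<bar>\<beta> t - \<beta> x\<bar> + B' t * (U t - L t) * \<bar>q t - q x\<bar>"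
      proof -
        have "0 \<le> (1 + q x) * ((L t - m) / \<beta> t)" "0 \<le> B' t * (U t - L t)"
          using c(1) UL(1) B'_nn[OF t] qx(1) by (intro mult_nonneg_nonneg; linarith)+
        from abs_mult_pos'[OF this(1)] abs_mult_pos'[OF this(2)] show ?thesis
          by (metis abs_triangle_ineq4)
      qed
      also have "\<dots> \<le> 2 * (C / \<beta> t) * \<bar>\<beta> t - \<beta> x\<bar> + B' t * W * \<bar>q t - q x\<bar>"
      proof -
        have "(1 + q x) * ((L t - m) / \<beta> t) \<le> 2 * (C / \<beta> t)"
          by (rule mult_mono[OF _ c(2) _ c(1)]) (use qx in simp_all)
        moreover have "B' t * (U t - L t) \<le> B' t * W"
          using UL(2) B'_nn[OF t] by (rule mult_left_mono)
        ultimately show ?thesis by (intro add_mono mult_right_mono abs_ge_zero)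
      qed
      also have "\<dots> \<le> (2 * (C / \<beta> t) * \<bar>\<beta> t - \<beta> x\<bar> / (1 - \<beta> x)) * D t + (W / (1 - q x) * \<bar>q t - q x\<bar>) * D t"
      proof (rule add_mono)
        have "0 \<le> 2 * (C / \<beta> t) * \<bar>\<beta> t - \<beta> x\<bar> / (1 - \<beta> x)"
          using order_trans[OF c] \<beta>x
          by (intro divide_nonneg_nonneg[of "_ * _"] mult_nonneg_nonneg[of _ "\<bar>_\<bar>"]
              mult_nonneg_nonneg[of 2]) auto
        \<comment> \<open>The factor \<open>1 - \<beta> x\<close> coming from \<open>D_ge(1)\<close>
          cancels the denominator.\<close>
        from mult_left_mono[OF D_ge(1)[OF t] this]
        show "2 * (C / \<beta> t) * \<bar>\<beta> t - \<beta> x\<bar> \<le> (2 * (C / \<beta> t) * \<bar>\<beta> t - \<beta> x\<bar> / (1 - \<beta> x)) * D t"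
          using \<beta>x by (subst (asm) nonzero_eq_divide_eq[THEN iffD1, OF _ refl]) simp_all
        have "0 \<le> W / (1 - q x) * \<bar>q t - q x\<bar>"
          using UL qx by simp
        then have "W / (1 - q x) * \<bar>q t - q x\<bar> * ((1 - q x) * B' t) \<le> (W / (1 - q x) * \<bar>q t - q x\<bar>) * D t"
          using mult_left_mono[OF D_ge(2)[OF t]] by blast
        then show "B' t * W * \<bar>q t - q x\<bar> \<le> (W / (1 - q x) * \<bar>q t - q x\<bar>) * D t"
          using qx by (simp add: mult_ac)
      qed
      finally show ?thesis
        unfolding distrib_right[symmetric] by (rule mult_right_le_imp_le) (rule D)
    qed
    have "((\<lambda>t. 2 * (C / \<beta> t) * \<bar>\<beta> t - \<beta> x\<bar> / (1 - \<beta> x) + W / (1 - q x) * \<bar>q t - q x\<bar>) \<longlongrightarrow>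
        2 * (C / \<beta> x) * \<bar>\<beta> x - \<beta> x\<bar> / (1 - \<beta> x) + W / (1 - q x) * \<bar>q x - q x\<bar>) ?F"
      using \<beta>x qx by (intro tendsto_intros \<beta>_lim q_lim) auto
    then have "((\<lambda>t. 2 * (C / \<beta> t) * \<bar>\<beta> t - \<beta> x\<bar> / (1 - \<beta> x) + W / (1 - q x) * \<bar>q t - q x\<bar>) \<longlongrightarrow> 0) ?F"
      by simp
    then have "((\<lambda>t. \<bar>L t - L x\<bar>) \<longlongrightarrow> 0) ?F"
      by (rule tendsto_sandwich[OF _ _ tendsto_const, rotated 2])
         (use bd ev in \<open>auto elim!: eventually_mono\<close>)
    then show ?thesis
      by (simp add: LIM_zero_iff tendsto_rabs_zero_iff)
  qed
  have U_eq: "U t = (T - (1 - q t) * L t) / (1 + q t)" if "t \<in> S" for t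
    using lin[OF that] q[OF that] by (simp add: field_simps)
  have "((\<lambda>t. (T - (1 - q t) * L t) / (1 + q t)) \<longlongrightarrow> (T - (1 - q x) * L x) / (1 + q x)) ?F"
    using qx by (intro tendsto_intros q_lim L_lim) auto
  then have U_lim: "(U \<longlongrightarrow> U x) ?F"
    unfolding U_eq[OF x, symmetric]
    by (rule Lim_transform_eventually) (use ev U_eq in \<open>auto elim!: eventually_mono\<close>)
  have "((\<lambda>t. G (U t)) \<longlongrightarrow> G (U x)) ?F" "((\<lambda>t. k (L t)) \<longlongrightarrow> k (L x)) ?F"
    "((\<lambda>t. s (U t)) \<longlongrightarrow> s (U x)) ?F"
    using isCont_tendsto_compose[OF DERIV_isCont[OF G_deriv] U_lim]
      isCont_tendsto_compose[OF sk(5) L_lim] isCont_tendsto_compose[OF sk(2) U_lim] .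
  then have "(A' \<longlongrightarrow> 1 - \<beta> x + \<beta> x * (G (U x) - k (L x))) ?F" "(B' \<longlongrightarrow> \<beta> x * s (U x)) ?F"
    unfolding A'_def B'_def by (auto intro!: tendsto_intros)
  then have A'_lim: "(A' \<longlongrightarrow> A) ?F" and B'_lim: "(B' \<longlongrightarrow> B) ?F"
    by (simp_all add: A_def B_def sk)
  have D_lim: "(D \<longlongrightarrow> (1 + q x) * A + (1 - q x) * B) ?F"
    unfolding D_def by (intro tendsto_intros A'_lim B'_lim)
  have "A' x = A" "B' x = B" by (simp_all add: A'_def B'_def A_def B_def sk)
  then have Dx: "0 < (1 + q x) * A + (1 - q x) * B"
    using D_ge(1)[OF x] \<beta>x by (simp add: D_def)
  have quot: "((\<lambda>t. (\<beta> t - \<beta> x) / (t - x)) \<longlongrightarrow> \<beta>') ?F" "((\<lambda>t. (q t - q x) / (t - x)) \<longlongrightarrow> q') ?F"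
    using \<beta>' q' by (simp_all add: has_field_derivative_iff)
  \<comment> \<open>The increment identity divided by \<open>D t * (t - x)\<close>: every factor now
    has a limit.\<close>
  have "((\<lambda>t. ((1 + q x) * ((L t - m) / \<beta> t) * ((\<beta> t - \<beta> x) / (t - x))
              - B' t * (U t - L t) * ((q t - q x) / (t - x))) / D t) \<longlongrightarrow> L') ?F"
    unfolding L'_def using Dx \<beta>x
    by (intro tendsto_intros quot L_lim U_lim B'_lim D_lim \<beta>_lim) auto
  then have "((\<lambda>t. (L t - L x) / (t - x)) \<longlongrightarrow> L') ?F"
  proof (rule Lim_transform_eventually)
    have "((1 + q x) * ((L t - m) / \<beta> t) * ((\<beta> t - \<beta> x) / (t - x))
              - B' t * (U t - L t) * ((q t - q x) / (t - x))) / D t = (L t - L x) / (t - x)"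
      if t: "t \<in> S" for t
    proof -
      have D: "D t \<noteq> 0" using D_ge(1)[OF t] \<beta>x by simp
      have "(1 + q x) * ((L t - m) / \<beta> t) * ((\<beta> t - \<beta> x) / (t - x))
              - B' t * (U t - L t) * ((q t - q x) / (t - x))
          = ((1 + q x) * ((L t - m) / \<beta> t) * (\<beta> t - \<beta> x) - B' t * (U t - L t) * (q t - q x)) / (t - x)"
        by (simp only: diff_divide_distrib[of "_ * _" "_ * _"] times_divide_eq_right)
      also have "\<dots> = D t * (L t - L x) / (t - x)" by (simp add: inc[OF t])
      finally show ?thesis using D by simp
    qed
    then show "\<forall>\<^sub>F t in ?F. ((1 + q x) * ((L t - m) / \<beta> t) * ((\<beta> t - \<beta> x) / (t - x))
              - B' t * (U t - L t) * ((q t - q x) / (t - x))) / D t = (L t - L x) / (t - x)"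
      using ev by (auto elim!: eventually_mono)
  qed
  then show L': "(L has_real_derivative L') ?F"
    by (simp add: has_field_derivative_iff)
  have N: "((\<lambda>t. T - (1 - q t) * L t) has_real_derivative q' * L x - (1 - q x) * L') ?F"
    by (auto intro!: derivative_eq_intros L' q')
  have "((\<lambda>t. 1 + q t) has_real_derivative q') ?F"
    by (auto intro!: derivative_eq_intros q')
  from DERIV_divide[OF N this]
  have "((\<lambda>t. (T - (1 - q t) * L t) / (1 + q t)) has_real_derivative
      ((q' * L x - (1 - q x) * L') * (1 + q x) - (T - (1 - q x) * L x) * q') / ((1 + q x) * (1 + q x))) ?F"
    using qx by simp
  also have "T - (1 - q x) * L x = (1 + q x) * U x"
    using lin[OF x] by simp
  also have "((q' * L x - (1 - q x) * L') * (1 + q x) - (1 + q x) * U x * q') / ((1 + q x) * (1 + q x))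
      = (1 + q x) * - (q' * (U x - L x) + (1 - q x) * L') / ((1 + q x) * (1 + q x))"
    by (simp add: algebra_simps)
  also have "\<dots> = - (q' * (U x - L x) + (1 - q x) * L') / (1 + q x)"
    using qx by simp
  finally have "((\<lambda>t. (T - (1 - q t) * L t) / (1 + q t)) has_real_derivative
      - (q' * (U x - L x) + (1 - q x) * L') / (1 + q x)) ?F" .
  then show "(U has_real_derivative - (q' * (U x - L x) + (1 - q x) * L') / (1 + q x)) ?F"
    unfolding has_field_derivative_def
    by (rule has_derivative_transform[OF x, rotated]) (use U_eq in auto)
qed

text \<open>With \<open>q\<close> constant, \<open>L'\<close> is a quotient of positive terms, and
  the second equation forces the slope of \<open>U\<close> to be \<open>- (1 - q) / (1 + q)\<close>
  times that of \<open>L\<close>.\<close>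

lemma competence_derivative:
  assumes T: "2 * m < T" and q: "0 \<le> q" "q < 1" and b: "b \<in> {0<..<1}"
    and e: "\<And>b. b \<in> {0<..<1} \<Longrightarrow> equilibrium T b q (L b) (U b)"
  shows "\<exists>D>0. (L has_real_derivative D) (at b)" "\<exists>D<0. (U has_real_derivative D) (at b)"
proof -
  define A where "A = 1 - b + b * (G (U b) - G (L b))"
  define B where "B = b * ((U b - L b) * g (U b))"
  define L' where "L' = (1 + q) * ((L b - m) / b) / ((1 + q) * A + (1 - q) * B)"
  have at: "at b within {0<..<1} = at b" using b by (intro at_within_open) auto
  have bnd: "m < L b" "L b < U b"
    using equilibrium_bounds[OF e[OF b] T _ _ q] b by auto
  then have "G (L b) < G (U b)" using G_strict_mono by simp
  then have AB: "0 < A" "0 < B" using b bnd g_pos by (auto simp: A_def B_def intro!: add_pos_pos)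
  note d = equilibrium_derivative[where S = "{0<..<1}" and \<beta> = "\<lambda>b. b" and q = "\<lambda>_. q" and x = b
      and L = L and U = U, OF T e _ _ _ _ b DERIV_ident DERIV_const]
  have "(L has_real_derivative ((1 + q) * ((L b - m) / b) * 1 - B * (U b - L b) * 0)
      / ((1 + q) * A + (1 - q) * B)) (at b within {0<..<1})"
    unfolding A_def B_def by (rule d(1)) (use q in simp_all)
  then have "(L has_real_derivative L') (at b)" by (simp add: at L'_def)
  moreover
  have "(U has_real_derivative - (0 * (U b - L b) + (1 - q) * (((1 + q) * ((L b - m) / b) * 1 - B * (U b - L b) * 0)
      / ((1 + q) * A + (1 - q) * B))) / (1 + q)) (at b within {0<..<1})"
    unfolding A_def B_def by (rule d(2)) (use q in simp_all)
  then have "(U has_real_derivative - ((1 - q) * L') / (1 + q)) (at b)" by (simp add: at L'_def)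
  moreover have "0 < L'"
    unfolding L'_def using AB bnd b q by (intro divide_pos_pos mult_pos_pos add_pos_nonneg) auto
  moreover have "- ((1 - q) * L') / (1 + q) < 0"
    using \<open>0 < L'\<close> q by (simp add: divide_neg_pos)
  ultimately show "\<exists>D>0. (L has_real_derivative D) (at b)" "\<exists>D<0. (U has_real_derivative D) (at b)"
    by blast+
qed

text \<open>The slopes of \<open>L\<close> and \<open>U\<close> are
  \<open>- B * (U q - L q) / C\<close> and \<open>- A * (U q - L q) / C\<close>. In the derivative
  of \<open>G (L q) - G (U q)\<close> the positive factor \<open>(U q - L q) * g (U q) / C\<close>
  splits off, leaving the stated sign. For the cdf this difference is the elaborateness minus
  1.\<close>

lemma environment_derivative:
  assumes T: "2 * m < T" and b: "0 < b" "b < 1" and q: "q \<in> {0..<1}"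
    and e: "\<And>q. q \<in> {0..<1} \<Longrightarrow> equilibrium T b q (L q) (U q)"
  shows "\<exists>D<0. (L has_real_derivative D) (at q within {0..<1})"
    and "\<exists>D<0. (U has_real_derivative D) (at q within {0..<1})"
    and "\<exists>D. ((\<lambda>q. G (L q) - G (U q)) has_real_derivative D) (at q within {0..<1}) \<and>
           sgn D = sgn (1 - b + b * (G (U q) - G (L q)) - b * ((U q - L q) * g (L q)))"
proof -
  define A where "A = 1 - b + b * (G (U q) - G (L q))"
  define B where "B = b * ((U q - L q) * g (U q))"
  define C where "C = (1 + q) * A + (1 - q) * B"
  have bnd: "L q < U q"
    using equilibrium_bounds[OF e[OF q] T b] q by auto
  then have "G (L q) < G (U q)" using G_strict_mono by simp
  then have AB: "0 < A" "0 < B" using b bnd g_pos by (auto simp: A_def B_def intro!: add_pos_pos)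
  then have C: "0 < C" using q by (auto simp: C_def intro!: add_pos_pos)
  note d = equilibrium_derivative[where S = "{0..<1}" and \<beta> = "\<lambda>_. b" and q = "\<lambda>q. q" and x = q
      and L = L and U = U, OF T e _ _ _ _ q DERIV_const DERIV_ident]
  have "(L has_real_derivative ((1 + q) * ((L q - m) / b) * 0 - B * (U q - L q) * 1) / C) (at q within {0..<1})"
    unfolding A_def B_def C_def by (rule d(1)) (use b in simp_all)
  then have L': "(L has_real_derivative - (B * (U q - L q)) / C) (at q within {0..<1})" by simp
  have "(U has_real_derivative - (1 * (U q - L q)
      + (1 - q) * (((1 + q) * ((L q - m) / b) * 0 - B * (U q - L q) * 1) / C)) / (1 + q)) (at q within {0..<1})"
    unfolding A_def B_def C_def by (rule d(2)) (use b in simp_all)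
  then have U': "(U has_real_derivative - ((U q - L q) + (1 - q) * (- (B * (U q - L q)) / C)) / (1 + q)) (at q within {0..<1})"
    by simp
  \<comment> \<open>The slope of \<open>U\<close> simplifies because
    \<open>C - (1 - q) * B = (1 + q) * A\<close>.\<close>
  have "(U q - L q) + (1 - q) * (- (B * (U q - L q)) / C) = (U q - L q) * (C - (1 - q) * B) / C"
    using C by (simp add: field_simps)
  also have "\<dots> = (1 + q) * (A * (U q - L q) / C)" by (simp add: C_def)
  finally have **: "- ((U q - L q) + (1 - q) * (- (B * (U q - L q)) / C)) / (1 + q) = - (A * (U q - L q)) / C"
    using q by simp
  note U' = U'[unfolded **]
  show "\<exists>D<0. (L has_real_derivative D) (at q within {0..<1})"
    using L' AB C bnd by (intro exI[of _ "- (B * (U q - L q)) / C"]) (simp add: divide_neg_pos)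
  show "\<exists>D<0. (U has_real_derivative D) (at q within {0..<1})"
    using U' AB C bnd by (intro exI[of _ "- (A * (U q - L q)) / C"]) (simp add: divide_neg_pos)
  let ?D = "g (L q) * (- (B * (U q - L q)) / C) - g (U q) * (- (A * (U q - L q)) / C)"
  have "((\<lambda>q. G (L q) - G (U q)) has_real_derivative ?D) (at q within {0..<1})"
    by (intro DERIV_diff DERIV_chain2[OF G_deriv] L' U')
  moreover have "sgn ?D = sgn (A - b * ((U q - L q) * g (L q)))"
  proof -
    have "?D = (U q - L q) * g (U q) / C * (A - b * ((U q - L q) * g (L q)))"
      using C by (simp add: B_def field_simps)
    moreover have "0 < (U q - L q) * g (U q) / C" using bnd C g_pos by simp
    ultimately show ?thesis by (simp only: sgn_mult sgn_pos mult_1)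
  qed
  ultimately show "\<exists>D. ((\<lambda>q. G (L q) - G (U q)) has_real_derivative D) (at q within {0..<1}) \<and>
           sgn D = sgn (1 - b + b * (G (U q) - G (L q)) - b * ((U q - L q) * g (L q)))"
    unfolding A_def by blast
qed

section \<open>Sign of the total effect of the environment\<close>

text \<open>Any pair \<open>m < l < u\<close> is the equilibrium of a suitable competence and target \<open>l + u\<close> at \<open>q = 0\<close>.
  Clearing the denominator of that competence in the sign condition of
  \<open>environment_derivative\<close> gives the following expression.\<close>

definition total_effect :: "real \<Rightarrow> real \<Rightarrow> real" where
  "total_effect l u = loss l u + (l - m) * (G u - G l) - (l - m) * ((u - l) * g l)"

text \<open>The first equation is linear in \<open>b\<close>; its solution lies strictly between 0
  and 1 because \<open>l - m\<close> and \<open>loss l u\<close> are both positive.\<close>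

lemma equilibrium_prescribed:
  assumes "m < l" "l < u"
  defines "b \<equiv> (l - m) / (l - m + loss l u)"
  shows "0 < b" "b < 1" "equilibrium (l + u) b 0 l u"
    "sgn (1 - b + b * (G u - G l) - b * ((u - l) * g l)) = sgn (total_effect l u)"
proof -
  define H where "H = loss l u"
  have H: "0 < H" unfolding H_def using assms loss_pos by simp
  have d: "0 < l - m + H" using H assms by simp
  have b: "b = (l - m) / (l - m + H)" "1 - b = H / (l - m + H)"
    using d unfolding b_def H_def by (auto simp: field_simps)
  show "0 < b" unfolding b(1) using assms(1) d by simp
  show "b < 1" unfolding b(1) using H d by simp
  show "equilibrium (l + u) b 0 l u"
    using \<open>l < u\<close> b by (simp add: equilibrium_def H_def)
  have "1 - b + b * (G u - G l) - b * ((u - l) * g l) = inverse (l - m + H) * total_effect l u"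
    unfolding b(2) unfolding b(1) total_effect_def H_def[symmetric]
    by (simp add: divide_inverse algebra_simps)
  then show "sgn (1 - b + b * (G u - G l) - b * ((u - l) * g l)) = sgn (total_effect l u)"
    using d by (simp add: sgn_mult)
qed

text \<open>At \<open>l = m\<close> only \<open>loss m u\<close> survives, which is positive;
  continuity preserves the sign for \<open>l\<close> slightly above \<open>m\<close>.\<close>

lemma total_effect_positive:
  assumes "isCont g m"
  shows "\<exists>l u. m < l \<and> l < u \<and> sgn (total_effect l u) = 1"
proof -
  have "isCont G m" "isCont K m"
    using G_deriv K_deriv by (auto intro: DERIV_isCont)
  then have "isCont (\<lambda>l. total_effect l (m + 1)) m"
    unfolding total_effect_def loss_def using assms by (intro continuous_intros)
  moreover have "0 < total_effect m (m + 1)"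
    using loss_pos[of m "m + 1"] by (simp add: total_effect_def)
  ultimately have "\<forall>\<^sub>F l in at m. 0 < total_effect l (m + 1)"
    by (simp add: isCont_def order_tendstoD)
  then have "\<forall>\<^sub>F l in at_right m. 0 < total_effect l (m + 1)"
    by (simp add: eventually_at_split)
  moreover have "\<forall>\<^sub>F l in at_right m. l \<in> {m<..<m + 1}"
    by (rule eventually_at_right_real) simp
  ultimately have "\<forall>\<^sub>F l in at_right m. 0 < total_effect l (m + 1) \<and> l \<in> {m<..<m + 1}"
    by (rule eventually_conj)
  then obtain l where "0 < total_effect l (m + 1)" "m < l" "l < m + 1"
    using eventually_happens'[OF trivial_limit_at_right_real[of m]] by auto
  then show ?thesis by (intro exI[of _ l] exI[of _ "m + 1"]) simp
qed

text \<open>For fixed \<open>l\<close> the subtracted term grows linearly in \<open>u\<close>,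
  whereas the loss grows at an arbitrarily small rate once \<open>G\<close> is close to its
  limit.\<close>

lemma total_effect_negative:
  assumes lim: "(G \<longlongrightarrow> c) at_top"
  shows "\<exists>l u. m < l \<and> l < u \<and> sgn (total_effect l u) = - 1"
proof -
  define l where "l = m + 1"
  define \<delta> where "\<delta> = g l"
  have \<delta>: "0 < \<delta>" using g_pos by (simp add: \<delta>_def)
  have G_le: "G x \<le> c" for x
    using lim by (rule tendsto_lowerbound)
      (auto simp: eventually_at_top_linorder intro!: exI[of _ x] G_mono)
  \<comment> \<open>Beyond \<open>y\<close> the loss grows at rate at most
    \<open>\<delta> / 2\<close>, half the rate \<open>\<delta>\<close> of the subtracted term, since
    \<open>l - m = 1\<close>.\<close>
  have "\<forall>\<^sub>F x in at_top. c - \<delta> / 2 < G x" using lim \<delta> by (simp add: order_tendstoD)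
  then have "\<forall>\<^sub>F x in at_top. c - \<delta> / 2 < G x \<and> l < x"
    using eventually_gt_at_top by (rule eventually_conj)
  then obtain y where y: "c - \<delta> / 2 < G y" "l < y"
    using eventually_happens'[OF trivial_limit_at_top_linorder] by blast
  \<comment> \<open>\<open>E\<close> bounds the contributions that do not grow with
    \<open>u\<close>: the loss on \<open>[l, y]\<close> and the term \<open>G u - G l\<close>. The
    later choice of \<open>u\<close> makes the total bound exactly
    \<open>- \<delta> / 2\<close>.\<close>
  define E where "E = (y - l + 1) * (c - G l)"
  have E: "0 \<le> E" unfolding E_def using y G_le[of l] by (intro mult_nonneg_nonneg) auto
  define u where "u = y + 2 * E / \<delta> + 1"
  have u: "y < u" using E \<delta> by (simp add: u_def add_nonneg_pos)
  obtain z where z: "y < z" "z < u" "K u - K y = (u - y) * G z" using K_increment[OF u] .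
  obtain w where w: "l < w" "w < y" "K y - K l = (y - l) * G w" using K_increment[OF y(2)] .
  have "loss l u = (u - y) * (G u - G z) + (y - l) * (G u - G w)"
    using z w by (simp add: loss_def algebra_simps)
  also have "\<dots> \<le> (u - y) * (\<delta> / 2) + (y - l) * (c - G l)"
    using z w y u G_le[of u] G_mono[of y z] G_mono[of l w]
    by (intro add_mono mult_left_mono) auto
  finally have "total_effect l u \<le> (u - y) * (\<delta> / 2) + E - (u - l) * \<delta>"
    using G_le[of u] by (simp add: total_effect_def E_def l_def \<delta>_def algebra_simps)
  also have "\<dots> \<le> (u - y) * (\<delta> / 2) + E - (u - y) * \<delta>"
    using mult_right_mono[of "u - y" "u - l" \<delta>] y \<delta> by linarith
  also have "\<dots> = - (\<delta> / 2)" using \<delta> by (simp add: u_def field_simps)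
  finally have "total_effect l u < 0" using \<delta> by simp
  then show ?thesis using y u by (intro exI[of _ l] exI[of _ u]) (simp add: l_def)
qed

end

subsection \<open>The disclosure model\<close>

context disclosure_model
begin

abbreviation F :: "real \<Rightarrow> real" where
  "F \<equiv> cdf (distr M borel X)"

lemma X_measurable [measurable]: "X \<in> borel_measurable M"
  using distributed_measurable[OF X_density] by simp

lemma R_measurable [measurable]: "R \<in> borel_measurable M"
  using R_integrable by (rule borel_measurable_integrable)

lemma distr_X: "distr M borel X = density lborel (\<lambda>t. ennreal (g t))"
  using distributed_distr_eq_density[OF X_density] by (simp cong: distr_cong)

sublocale X: real_distribution "distr M borel X"
  by simp

lemma R_mean_positive: "0 < expectation R"
  by (rule expectation_greater[OF R_integrable R_positive])

text \<open>The continuous density has an antiderivative on the whole line. Its increments are the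
  probabilities of intervals, so it differs from the cdf by a constant.\<close>

lemma cdf_deriv: "(F has_real_derivative g x) (at x)"
proof -
  have "\<exists>\<Gamma>. \<forall>x. - \<infinity> < ereal x \<longrightarrow> ereal x < \<infinity> \<longrightarrow> (\<Gamma> has_vector_derivative g x) (at x)"
    by (rule einterval_antiderivative)
       (use g_continuous in \<open>auto simp: continuous_on_eq_continuous_at\<close>)
  then obtain \<Gamma> where \<Gamma>: "\<And>x. (\<Gamma> has_real_derivative g x) (at x)"
    by (auto simp: has_real_derivative_iff_has_vector_derivative)
  have incr: "F b - F a = \<Gamma> b - \<Gamma> a" if "a < b" for a b
  proof -
    have [measurable]: "g \<in> borel_measurable borel"
      using g_continuous by (rule borel_measurable_continuous_onI)
    have \<Gamma>_mono: "\<Gamma> a \<le> \<Gamma> b"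
      using DERIV_pos_imp_increasing[OF that, of \<Gamma>] \<Gamma> g_positive by (meson less_imp_le)
    have "emeasure (distr M borel X) {a<..b} = (\<integral>\<^sup>+x. ennreal (g x) * indicator {a<..b} x \<partial>lborel)"
      unfolding distr_X by (simp add: emeasure_density)
    \<comment> \<open>The added endpoint \<open>a\<close> is a null set.\<close>
    also have "\<dots> = (\<integral>\<^sup>+x. ennreal (g x) * indicator {a..b} x \<partial>lborel)"
      by (intro nn_integral_cong_AE eventually_mono[OF AE_lborel_singleton[of a]])
         (auto split: split_indicator)
    also have "\<dots> = ennreal (\<Gamma> b - \<Gamma> a)"
      using \<Gamma> g_positive that by (intro nn_integral_FTC_Icc) (auto intro: less_imp_le)
    finally show ?thesis
      using \<Gamma>_mono by (simp add: X.cdf_diff_eq[OF that] measure_def)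
  qed
  have "F = (\<lambda>x. \<Gamma> x + (F 0 - \<Gamma> 0))"
  proof
    fix x show "F x = \<Gamma> x + (F 0 - \<Gamma> 0)"
      using incr[of x 0] incr[of 0 x] by (cases x "0 :: real" rule: linorder_cases) auto
  qed
  moreover have "((\<lambda>x. \<Gamma> x + (F 0 - \<Gamma> 0)) has_real_derivative g x) (at x)"
    by (auto intro!: derivative_eq_intros \<Gamma>)
  ultimately show ?thesis by simp
qed

lemma cdf_strict_mono: "x < y \<Longrightarrow> F x < F y"
  by (rule DERIV_pos_imp_increasing) (use cdf_deriv g_positive in auto)

lemma cdf_antiderivative: "\<exists>K. \<forall>x. (K has_real_derivative F x) (at x)"
proof -
  have "\<exists>K. \<forall>x. - \<infinity> < ereal x \<longrightarrow> ereal x < \<infinity> \<longrightarrow> (K has_vector_derivative F x) (at x)"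
    by (rule einterval_antiderivative) (auto intro: DERIV_isCont cdf_deriv)
  then show ?thesis by (auto simp: has_real_derivative_iff_has_vector_derivative)
qed

text \<open>The cdf is continuous, so the threshold carries no mass and strict inequality may
  replace the weak one.\<close>

lemma negative_frequency_eq: "negative_frequency M R X r b q = F (lower_threshold M R X r b q)"
proof -
  let ?l = "lower_threshold M R X r b q"
  have "measure (distr M borel X) {?l} = 0"
    using DERIV_isCont[OF cdf_deriv] X.isCont_cdf by blast
  moreover have "F ?l = measure (distr M borel X) {..<?l} + measure (distr M borel X) {?l}"
    unfolding cdf_def ivl_disj_un(2)[symmetric]
    by (rule X.finite_measure_Union) auto
  ultimately show ?thesis
    by (simp add: negative_frequency_def measure_distr vimage_def Int_def conj_commute)
qed

lemma positive_frequency_eq: "positive_frequency M R X r b q = 1 - F (upper_threshold M R X r b q)"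
proof -
  let ?u = "upper_threshold M R X r b q"
  have "{?u<..} = space (distr M borel X) - {..?u}" by auto
  then have "measure (distr M borel X) {?u<..} = 1 - F ?u"
    unfolding cdf_def using X.prob_compl[of "{..?u}"] by simp
  then show ?thesis
    by (simp add: positive_frequency_def measure_distr vimage_def Int_def conj_commute)
qed

lemma elaborateness_eq:
  "elaborateness M R X r b q = F (lower_threshold M R X r b q) + (1 - F (upper_threshold M R X r b q))"
  by (simp add: elaborateness_def negative_frequency_eq positive_frequency_eq)

section \<open>Transport of the model to its joint law\<close>

text \<open>The witnesses required by \<open>q_effect_possible\<close> live on \<open>real \<times> real\<close>; the joint law of \<open>R\<close> and a
  translate of \<open>X\<close> in any given model supplies them.\<close>

definition joint_law :: "real \<Rightarrow> (real \<times> real) measure" where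
  "joint_law c = distr M (borel \<Otimes>\<^sub>M borel) (\<lambda>\<omega>. (R \<omega>, X \<omega> + c))"

lemma joint_measurable [measurable]: "(\<lambda>\<omega>. (R \<omega>, X \<omega> + c)) \<in> M \<rightarrow>\<^sub>M borel \<Otimes>\<^sub>M borel"
  by measurable

lemma distr_fst_joint: "distr (joint_law c) borel fst = distr M borel R"
  unfolding joint_law_def by (subst distr_distr) (auto simp: comp_def)

lemma distr_snd_joint: "distr (joint_law c) borel snd = distr M borel (\<lambda>\<omega>. X \<omega> + c)"
  unfolding joint_law_def by (subst distr_distr) (auto simp: comp_def)

lemma expectation_snd_joint: "integral\<^sup>L (joint_law c) snd = expectation X + c"
  unfolding joint_law_def using X_integrable by (subst integral_distr) (auto simp: prob_space)

lemma cdf_snd_joint: "cdf (distr (joint_law c) borel snd) x = F (x - c)"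
proof -
  have "measure M ((\<lambda>\<omega>. X \<omega> + c) -` {..x} \<inter> space M) = measure M (X -` {..x - c} \<inter> space M)"
    by (rule arg_cong[where f = "measure M"]) auto
  then show ?thesis by (simp add: distr_snd_joint cdf_def measure_distr)
qed

lemma disclosure_model_joint:
  assumes "0 < expectation X + c"
  shows "disclosure_model (joint_law c) fst snd (\<lambda>t. g (t - c))"
proof -
  interpret J: prob_space "joint_law c"
    unfolding joint_law_def by (rule prob_space_distr) simp
  have [measurable_cong]: "sets (joint_law c) = sets (borel \<Otimes>\<^sub>M borel)"
    by (simp add: joint_law_def)
  obtain f :: "real \<Rightarrow> real" where f: "distributed M lborel R (\<lambda>t. ennreal (f t))"
    using R_continuous by blast
  \<comment> \<open>\<open>distributed\<close> refers to \<open>lborel\<close>, the image laws to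
    \<open>borel\<close>; only the common sigma-algebra matters.\<close>
  have lborel: "distr N lborel Y = distr N borel Y" for N :: "(real \<times> real) measure" and Y :: "_ \<Rightarrow> real"
    by (rule distr_cong) auto
  have lborel': "distr M lborel Y = distr M borel Y" for Y :: "_ \<Rightarrow> real"
    by (rule distr_cong) auto
  show ?thesis
  proof
    have "distributed (joint_law c) lborel fst (\<lambda>t. ennreal (f t))"
      using f by (auto simp: distributed_def lborel lborel' distr_fst_joint)
    then show "\<exists>f :: real \<Rightarrow> real. distributed (joint_law c) lborel fst (\<lambda>t. ennreal (f t))"
      by (intro exI[of _ f])
    show "AE \<omega> in joint_law c. 0 < fst \<omega>"
      unfolding joint_law_def using R_positive by (subst AE_distr_iff) auto
    show "integrable (joint_law c) fst"
      unfolding joint_law_def using R_integrable by (subst integrable_distr_eq) auto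
    have "distributed M lborel (\<lambda>\<omega>. X \<omega> + c) (\<lambda>t. ennreal (g (t - c)))"
      using distributed_affine[OF X_density, of 1 c]
      by (simp add: add.commute[of c] divide_ennreal_def)
    then show "distributed (joint_law c) lborel snd (\<lambda>t. ennreal (g (t - c)))"
      by (auto simp: distributed_def lborel lborel' distr_snd_joint)
    show "continuous_on UNIV (\<lambda>t. g (t - c))"
      by (intro continuous_on_compose2[OF g_continuous] continuous_intros) auto
    show "0 < g (t - c)" for t by (rule g_positive)
    show "integrable (joint_law c) snd"
      unfolding joint_law_def using X_integrable by (subst integrable_distr_eq) auto
    show "0 < J.expectation snd" using assms by (simp add: expectation_snd_joint)
    \<comment> \<open>Translation preserves independence, so the joint law is the product of its
      marginals, which is independence of the coordinates.\<close>
    have "indep_var borel ((\<lambda>x. x) \<circ> R) borel ((\<lambda>x. x + c) \<circ> X)"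
      by (rule indep_var_compose[OF independent]) auto
    then have "distr M borel R \<Otimes>\<^sub>M distr M borel (\<lambda>\<omega>. X \<omega> + c) = joint_law c"
      by (simp add: indep_var_distribution_eq joint_law_def comp_def)
    moreover have "distr (joint_law c) (borel \<Otimes>\<^sub>M borel) (\<lambda>x. x) = joint_law c"
      by (rule distr_id2) (simp add: joint_law_def)
    ultimately show "J.indep_var borel fst borel snd"
      by (simp add: J.indep_var_distribution_eq distr_fst_joint distr_snd_joint)
  qed
qed

end

section \<open>Reflection and identification of the thresholds\<close>

text \<open>The substitution \<open>x \<mapsto> - x\<close> exchanges the two thresholds and turns the system for \<open>r > r0\<close> into
  that for \<open>r < r0\<close>, with \<open>- F (- x)\<close> in place of the cdf (which matters only up to a constant).\<close>

locale disclosure_antiderivative = disclosure_model +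
  fixes K :: "real \<Rightarrow> real"
  assumes cdf_antideriv: "\<And>x. (K has_real_derivative F x) (at x)"
begin

sublocale low: withholding F K g "expectation X"
  by standard (use cdf_antideriv cdf_deriv g_positive in auto)

sublocale high: withholding "\<lambda>x. - F (- x)" "\<lambda>x. K (- x)" "\<lambda>x. g (- x)" "- expectation X"
proof
  fix x
  show "((\<lambda>x. K (- x)) has_real_derivative - F (- x)) (at x)"
    by (rule DERIV_cong[OF DERIV_chain2[OF cdf_antideriv]]) (auto intro!: derivative_eq_intros)
  show "((\<lambda>x. - F (- x)) has_real_derivative g (- x)) (at x)"
    by (rule DERIV_cong[OF DERIV_minus[OF DERIV_chain2[OF cdf_deriv]]])
       (auto intro!: derivative_eq_intros)
  show "0 < g (- x)" by (rule g_positive)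
qed

lemma integral_cdf_diff:
  assumes "l \<le> u"
  shows "integral {l..u} (\<lambda>x. F x - c) = K u - K l - (u - l) * c"
proof -
  have "((\<lambda>x. K x - c * x) has_vector_derivative F x - c) (at x within {l..u})" for x
    unfolding has_real_derivative_iff_has_vector_derivative[symmetric]
    by (auto intro!: derivative_eq_intros DERIV_subset[OF cdf_antideriv])
  from integral_unique[OF fundamental_theorem_of_calculus[OF assms this]] show ?thesis
    by (simp add: algebra_simps)
qed

definition target :: "real \<Rightarrow> real" where
  "target r = 2 * expectation R * expectation X / r"

lemma threshold_system_low:
  assumes "r < expectation R"
  shows "threshold_system F (expectation X) (expectation R) r b q l u \<longleftrightarrow>
    low.equilibrium (target r) b q l u"
  using assms
  by (auto simp: threshold_system_def low.equilibrium_def low.loss_def target_def integral_cdf_diff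
      algebra_simps)

text \<open>The loss of the reflected system at \<open>(- u, - l)\<close> is the integral of
  \<open>F x - F l\<close> over \<open>[l, u]\<close>; the linear equation is merely
  negated.\<close>

lemma threshold_system_high:
  assumes "expectation R < r"
  shows "threshold_system F (expectation X) (expectation R) r b q l u \<longleftrightarrow>
    high.equilibrium (- target r) b q (- u) (- l)"
  using assms
  by (auto simp: threshold_system_def high.equilibrium_def high.loss_def target_def
      integral_cdf_diff algebra_simps)

lemma target_low:
  assumes "0 < r" "r < expectation R"
  shows "2 * expectation X < target r"
  using assms X_mean_positive by (simp add: target_def field_simps)

lemma target_high:
  assumes "expectation R < r"
  shows "2 * (- expectation X) < - target r"
  using assms X_mean_positive R_mean_positive by (simp add: target_def field_simps)

lemma thresholds_unique:
  assumes "threshold_system F (expectation X) (expectation R) r b q l u"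
    and "\<And>l' u'. threshold_system F (expectation X) (expectation R) r b q l' u' \<Longrightarrow> l' = l \<and> u' = u"
  shows "lower_threshold M R X r b q = l" "upper_threshold M R X r b q = u"
proof -
  have "thresholds M R X r b q = (l, u)"
    unfolding thresholds_def
  proof (rule the_equality)
    show "threshold_system F (expectation X) (expectation R) r b q (fst (l, u)) (snd (l, u))"
      using assms(1) by simp
  next
    fix p assume "threshold_system F (expectation X) (expectation R) r b q (fst p) (snd p)"
    from assms(2)[OF this] show "p = (l, u)" by (simp add: prod_eq_iff)
  qed
  then show "lower_threshold M R X r b q = l" "upper_threshold M R X r b q = u"
    by (simp_all add: lower_threshold_def upper_threshold_def)
qed

text \<open>It serves twice: with the solution from \<open>equilibrium_exists\<close> it shows that
  the thresholds solve the system, and with a prescribed pair it evaluates them.\<close>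

lemma thresholds_low_eqI:
  assumes r: "0 < r" "r < expectation R" and b: "b \<in> {0<..<1}" and q: "q \<in> {0..<1}"
    and e: "low.equilibrium (target r) b q l u"
  shows "lower_threshold M R X r b q = l" "upper_threshold M R X r b q = u"
proof -
  have "l' = l \<and> u' = u" if "low.equilibrium (target r) b q l' u'" for l' u'
    by (rule low.equilibrium_unique[OF target_low[OF r] _ _ _ _ that e]) (use b q in simp_all)
  note u = thresholds_unique[of r b q l u, unfolded threshold_system_low[OF r(2)], OF e this]
  show "lower_threshold M R X r b q = l" "upper_threshold M R X r b q = u" by (rule u; assumption)+
qed

lemma thresholds_high_eqI:
  assumes r: "expectation R < r" and b: "b \<in> {0<..<1}" and q: "q \<in> {0..<1}"
    and e: "high.equilibrium (- target r) b q (- u) (- l)"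
  shows "lower_threshold M R X r b q = l" "upper_threshold M R X r b q = u"
proof -
  have "l' = l \<and> u' = u" if "high.equilibrium (- target r) b q (- u') (- l')" for l' u'
  proof -
    have "- u' = - u \<and> - l' = - l"
      by (rule high.equilibrium_unique[OF target_high[OF r] _ _ _ _ that e]) (use b q in simp_all)
    then show ?thesis by simp
  qed
  note u = thresholds_unique[of r b q l u, unfolded threshold_system_high[OF r], OF e this]
  show "lower_threshold M R X r b q = l" "upper_threshold M R X r b q = u" by (rule u; assumption)+
qed

lemma equilibrium_low:
  assumes r: "0 < r" "r < expectation R" and b: "b \<in> {0<..<1}" and q: "q \<in> {0..<1}"
  shows "low.equilibrium (target r) b q (lower_threshold M R X r b q) (upper_threshold M R X r b q)"
proof -
  obtain l u where "low.equilibrium (target r) b q l u"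
    using low.equilibrium_exists[OF target_low[OF r], of b q] b q by auto
  with thresholds_low_eqI[OF r b q this] show ?thesis by simp
qed

lemma equilibrium_high:
  assumes r: "expectation R < r" and b: "b \<in> {0<..<1}" and q: "q \<in> {0..<1}"
  shows "high.equilibrium (- target r) b q
    (- upper_threshold M R X r b q) (- lower_threshold M R X r b q)"
proof -
  obtain l' u' where "high.equilibrium (- target r) b q l' u'"
    using high.equilibrium_exists[OF target_high[OF r], of b q] b q by auto
  then have e: "high.equilibrium (- target r) b q (- (- l')) (- (- u'))" by simp
  with thresholds_high_eqI[OF r b q e] show ?thesis by simp
qed

section \<open>Comparative statics of thresholds and frequencies\<close>

lemma competence_effect_low:
  assumes r: "0 < r" "r < expectation R" and b: "b \<in> {0<..<1}" and q: "q \<in> {0..<1}"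
  shows "\<exists>D>0. ((\<lambda>b. lower_threshold M R X r b q) has_real_derivative D) (at b)"
    and "\<exists>D<0. ((\<lambda>b. upper_threshold M R X r b q) has_real_derivative D) (at b)"
proof -
  have q': "0 \<le> q" "q < 1" using q by auto
  note e = equilibrium_low[OF r _ q]
  note d = low.competence_derivative[where L = "\<lambda>b. lower_threshold M R X r b q"
      and U = "\<lambda>b. upper_threshold M R X r b q", OF target_low[OF r] q' b e]
  show "\<exists>D>0. ((\<lambda>b. lower_threshold M R X r b q) has_real_derivative D) (at b)"
    by (rule d(1); assumption)
  show "\<exists>D<0. ((\<lambda>b. upper_threshold M R X r b q) has_real_derivative D) (at b)"
    by (rule d(2); assumption)
qed

lemma competence_effect_high:
  assumes r: "expectation R < r" and b: "b \<in> {0<..<1}" and q: "q \<in> {0..<1}"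
  shows "\<exists>D>0. ((\<lambda>b. lower_threshold M R X r b q) has_real_derivative D) (at b)"
    and "\<exists>D<0. ((\<lambda>b. upper_threshold M R X r b q) has_real_derivative D) (at b)"
proof -
  have q': "0 \<le> q" "q < 1" using q by auto
  note e = equilibrium_high[OF r _ q]
  note d = high.competence_derivative[where L = "\<lambda>b. - upper_threshold M R X r b q"
      and U = "\<lambda>b. - lower_threshold M R X r b q", OF target_high[OF r] q' b e]
  have "\<exists>D<0. ((\<lambda>b. - lower_threshold M R X r b q) has_real_derivative D) (at b)"
    by (rule d(2); assumption)
  then show "\<exists>D>0. ((\<lambda>b. lower_threshold M R X r b q) has_real_derivative D) (at b)"
    by (simp only: deriv_neg_minus_iff)
  have "\<exists>D>0. ((\<lambda>b. - upper_threshold M R X r b q) has_real_derivative D) (at b)"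
    by (rule d(1); assumption)
  then show "\<exists>D<0. ((\<lambda>b. upper_threshold M R X r b q) has_real_derivative D) (at b)"
    by (simp only: deriv_neg_minus_iff[symmetric] minus_minus)
qed

lemma environment_effect_low:
  assumes r: "0 < r" "r < expectation R" and b: "b \<in> {0<..<1}" and q: "q \<in> {0..<1}"
  shows "\<exists>D<0. ((\<lambda>p. lower_threshold M R X r b p) has_real_derivative D) (at q within {0..<1})"
    and "\<exists>D<0. ((\<lambda>p. upper_threshold M R X r b p) has_real_derivative D) (at q within {0..<1})"
proof -
  have b': "0 < b" "b < 1" using b by auto
  note d = low.environment_derivative[where L = "\<lambda>p. lower_threshold M R X r b p"
      and U = "\<lambda>p. upper_threshold M R X r b p", OF target_low[OF r] b' q equilibrium_low[OF r b]]
  show "\<exists>D<0. ((\<lambda>p. lower_threshold M R X r b p) has_real_derivative D) (at q within {0..<1})"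
    by (rule d(1); assumption)
  show "\<exists>D<0. ((\<lambda>p. upper_threshold M R X r b p) has_real_derivative D) (at q within {0..<1})"
    by (rule d(2); assumption)
qed

lemma environment_effect_high:
  assumes r: "expectation R < r" and b: "b \<in> {0<..<1}" and q: "q \<in> {0..<1}"
  shows "\<exists>D>0. ((\<lambda>p. lower_threshold M R X r b p) has_real_derivative D) (at q within {0..<1})"
    and "\<exists>D>0. ((\<lambda>p. upper_threshold M R X r b p) has_real_derivative D) (at q within {0..<1})"
proof -
  have b': "0 < b" "b < 1" using b by auto
  note d = high.environment_derivative[where L = "\<lambda>p. - upper_threshold M R X r b p"
      and U = "\<lambda>p. - lower_threshold M R X r b p", OF target_high[OF r] b' q equilibrium_high[OF r b]]
  have "\<exists>D<0. ((\<lambda>p. - lower_threshold M R X r b p) has_real_derivative D) (at q within {0..<1})"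
    by (rule d(2); assumption)
  then show "\<exists>D>0. ((\<lambda>p. lower_threshold M R X r b p) has_real_derivative D) (at q within {0..<1})"
    by (simp only: deriv_neg_minus_iff)
  have "\<exists>D<0. ((\<lambda>p. - upper_threshold M R X r b p) has_real_derivative D) (at q within {0..<1})"
    by (rule d(1); assumption)
  then show "\<exists>D>0. ((\<lambda>p. upper_threshold M R X r b p) has_real_derivative D) (at q within {0..<1})"
    by (simp only: deriv_neg_minus_iff)
qed

lemma elaborateness_strict_monoI:
  assumes "\<And>b. b \<in> {0<..<1} \<Longrightarrow> \<exists>D>0. ((\<lambda>b. lower_threshold M R X r b q) has_real_derivative D) (at b)"
    and "\<And>b. b \<in> {0<..<1} \<Longrightarrow> \<exists>D<0. ((\<lambda>b. upper_threshold M R X r b q) has_real_derivative D) (at b)"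
  shows "strict_mono_on {0<..<1} (\<lambda>b. elaborateness M R X r b q)"
proof -
  have I: "is_interval {0<..<1 :: real}" by (simp add: is_interval_1)
  have "strict_antimono_on {0<..<1} (\<lambda>b. upper_threshold M R X r b q)"
    by (rule neg_deriv_imp_strict_antimono_on[OF I])
       (use assms(2) in \<open>blast intro: has_field_derivative_at_within\<close>)
  moreover have "strict_mono_on {0<..<1} (\<lambda>b. lower_threshold M R X r b q)"
    by (rule pos_deriv_imp_strict_mono_on[OF I])
       (use assms(1) in \<open>blast intro: has_field_derivative_at_within\<close>)
  ultimately show ?thesis
    unfolding monotone_on_def elaborateness_eq
    by (fast intro: add_strict_mono diff_strict_left_mono cdf_strict_mono)
qed

lemma elaborateness_strict_mono_low:
  assumes r: "0 < r" "r < expectation R" and q: "q \<in> {0..<1}"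
  shows "strict_mono_on {0<..<1} (\<lambda>b. elaborateness M R X r b q)"
  by (rule elaborateness_strict_monoI; rule competence_effect_low[OF r _ q]; assumption)

lemma elaborateness_strict_mono_high:
  assumes r: "expectation R < r" and q: "q \<in> {0..<1}"
  shows "strict_mono_on {0<..<1} (\<lambda>b. elaborateness M R X r b q)"
  by (rule elaborateness_strict_monoI; rule competence_effect_high[OF r _ q]; assumption)

lemma frequency_low:
  assumes r: "0 < r" "r < expectation R" and b: "b \<in> {0<..<1}"
  shows "strict_antimono_on {0..<1} (\<lambda>p. negative_frequency M R X r b p)"
    and "strict_mono_on {0..<1} (\<lambda>p. positive_frequency M R X r b p)"
proof -
  have I: "is_interval {0..<1 :: real}" by (simp add: is_interval_1)
  have "strict_antimono_on {0..<1} (\<lambda>p. lower_threshold M R X r b p)"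
    "strict_antimono_on {0..<1} (\<lambda>p. upper_threshold M R X r b p)"
    by (rule neg_deriv_imp_strict_antimono_on[OF I]; rule environment_effect_low[OF r b]; assumption)+
  then show "strict_antimono_on {0..<1} (\<lambda>p. negative_frequency M R X r b p)"
    "strict_mono_on {0..<1} (\<lambda>p. positive_frequency M R X r b p)"
    unfolding monotone_on_def negative_frequency_eq positive_frequency_eq
    by (auto intro!: diff_strict_left_mono cdf_strict_mono)
qed

lemma frequency_high:
  assumes r: "expectation R < r" and b: "b \<in> {0<..<1}"
  shows "strict_antimono_on {0..<1} (\<lambda>p. positive_frequency M R X r b p)"
    and "strict_mono_on {0..<1} (\<lambda>p. negative_frequency M R X r b p)"
proof -
  have I: "is_interval {0..<1 :: real}" by (simp add: is_interval_1)
  have "strict_mono_on {0..<1} (\<lambda>p. lower_threshold M R X r b p)"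
    "strict_mono_on {0..<1} (\<lambda>p. upper_threshold M R X r b p)"
    by (rule pos_deriv_imp_strict_mono_on[OF I]; rule environment_effect_high[OF r b]; assumption)+
  then show "strict_antimono_on {0..<1} (\<lambda>p. positive_frequency M R X r b p)"
    "strict_mono_on {0..<1} (\<lambda>p. negative_frequency M R X r b p)"
    unfolding monotone_on_def negative_frequency_eq positive_frequency_eq
    by (auto intro!: diff_strict_left_mono cdf_strict_mono)
qed

lemma total_effect_low:
  assumes l: "expectation X < l" and u: "l < u"
  shows "\<exists>r b d. 0 < r \<and> r < expectation R \<and> b \<in> {0<..<1} \<and>
    (elaborateness M R X r b has_real_derivative d) (at 0 within {0..<1}) \<and>
    sgn d = sgn (low.total_effect l u)"
proof -
  define b where "b = (l - expectation X) / (l - expectation X + low.loss l u)"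
  \<comment> \<open>This realization makes \<open>target r = l + u\<close>; it lies below the mean
    of \<open>R\<close> because \<open>l + u\<close> exceeds twice the mean of
    \<open>X\<close>.\<close>
  define r where "r = 2 * expectation R * expectation X / (l + u)"
  note e = low.equilibrium_prescribed[OF l u, folded b_def]
  have pos: "0 < l + u" "2 * expectation X < l + u" using l u X_mean_positive by auto
  have "expectation R * (2 * expectation X) < expectation R * (l + u)"
    by (rule mult_strict_left_mono[OF pos(2) R_mean_positive])
  then have r: "0 < r" "r < expectation R"
    using pos X_mean_positive R_mean_positive unfolding r_def
    by (simp_all add: pos_divide_less_eq mult_ac)
  have "target r = l + u"
    using pos X_mean_positive R_mean_positive by (simp add: target_def r_def)
  then have e': "low.equilibrium (target r) b 0 l u" using e(3) by simp
  have b: "b \<in> {0<..<1}" using e by simp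
  have q0: "0 \<in> {0..<1 :: real}" by simp
  note th = thresholds_low_eqI[OF r b q0 e']
  have "\<exists>d. ((\<lambda>q. F (lower_threshold M R X r b q) - F (upper_threshold M R X r b q))
        has_real_derivative d) (at 0 within {0..<1}) \<and> sgn d = sgn (low.total_effect l u)"
    using low.environment_derivative(3)[where L = "lower_threshold M R X r b"
        and U = "upper_threshold M R X r b", OF target_low[OF r] e(1,2) q0, OF equilibrium_low[OF r b]]
    unfolding th e(4) .
  then obtain d where d: "((\<lambda>q. F (lower_threshold M R X r b q) - F (upper_threshold M R X r b q))
        has_real_derivative d) (at 0 within {0..<1})" "sgn d = sgn (low.total_effect l u)" by blast
  have "elaborateness M R X r b =
      (\<lambda>q. 1 + (F (lower_threshold M R X r b q) - F (upper_threshold M R X r b q)))"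
    by (auto simp: elaborateness_eq)
  then have "(elaborateness M R X r b has_real_derivative d) (at 0 within {0..<1})"
    using DERIV_add[OF DERIV_const[of 1] d(1)] by simp
  then show ?thesis using r b d(2) by blast
qed

lemma total_effect_high:
  assumes l: "- expectation X < l" and u: "l < u" and lu: "l + u < 0"
  shows "\<exists>r b d. expectation R < r \<and> b \<in> {0<..<1} \<and>
    (elaborateness M R X r b has_real_derivative d) (at 0 within {0..<1}) \<and>
    sgn d = sgn (high.total_effect l u)"
proof -
  define b where "b = (l - (- expectation X)) / (l - (- expectation X) + high.loss l u)"
  \<comment> \<open>The original thresholds are \<open>- u\<close> and \<open>- l\<close>, so the
    target must be \<open>- (l + u)\<close>. It is positive by \<open>lu\<close> and below twice the
    mean of \<open>X\<close>, which puts \<open>r\<close> above the mean of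
    \<open>R\<close>.\<close>
  define r where "r = 2 * expectation R * expectation X / (- (l + u))"
  note e = high.equilibrium_prescribed[OF l u, folded b_def]
  have pos: "- (l + u) < 2 * expectation X" using l u X_mean_positive by auto
  have "expectation R * (- (l + u)) < expectation R * (2 * expectation X)"
    by (rule mult_strict_left_mono[OF pos R_mean_positive])
  then have r: "expectation R < r"
    using lu unfolding r_def by (subst pos_less_divide_eq) (auto simp: algebra_simps)
  have "- target r = l + u"
    using lu X_mean_positive R_mean_positive by (simp add: target_def r_def field_simps)
  then have e': "high.equilibrium (- target r) b 0 (- (- l)) (- (- u))" using e(3) by simp
  have b: "b \<in> {0<..<1}" using e by simp
  have q0: "0 \<in> {0..<1 :: real}" by simp
  note th = thresholds_high_eqI[OF r b q0 e']
  have "\<exists>d. ((\<lambda>q. - F (upper_threshold M R X r b q) - - F (lower_threshold M R X r b q))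
        has_real_derivative d) (at 0 within {0..<1}) \<and> sgn d = sgn (high.total_effect l u)"
    using high.environment_derivative(3)[where L = "\<lambda>p. - upper_threshold M R X r b p"
        and U = "\<lambda>p. - lower_threshold M R X r b p", OF target_high[OF r] e(1,2) q0,
        OF equilibrium_high[OF r b]]
    unfolding th minus_minus e(4)[unfolded minus_minus] .
  then obtain d where d: "((\<lambda>q. - F (upper_threshold M R X r b q) - - F (lower_threshold M R X r b q))
        has_real_derivative d) (at 0 within {0..<1})" "sgn d = sgn (high.total_effect l u)" by blast
  have "elaborateness M R X r b =
      (\<lambda>q. 1 + (- F (upper_threshold M R X r b q) - - F (lower_threshold M R X r b q)))"
    by (auto simp: elaborateness_eq)
  then have "(elaborateness M R X r b has_real_derivative d) (at 0 within {0..<1})"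
    using DERIV_add[OF DERIV_const[of 1] d(1)] by simp
  then show ?thesis using r b d(2) by blast
qed

subsection \<open>Ambiguity of the effect of the information environment\<close>

lemma disclosure_antiderivative_joint:
  assumes "0 < expectation X + c"
  shows "disclosure_antiderivative (joint_law c) fst snd (\<lambda>t. g (t - c)) (\<lambda>x. K (x - c))"
proof -
  have "((\<lambda>x. K (x - c)) has_real_derivative cdf (distr (joint_law c) borel snd) x) (at x)" for x
    unfolding cdf_snd_joint
    by (rule DERIV_cong[OF DERIV_chain2[OF cdf_antideriv]]) (auto intro!: derivative_eq_intros)
  then show ?thesis
    using disclosure_model_joint[OF assms]
    by (simp add: disclosure_antiderivative_def disclosure_antiderivative_axioms_def)
qed

text \<open>The model may live on any type, whereas \<open>q_effect_possible\<close> asks for a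
  measure on pairs of reals; the joint law without translation bridges the gap.\<close>

lemma q_effect_possible_low:
  assumes "expectation X < l" "l < u"
  shows "q_effect_possible (<) (sgn (low.total_effect l u))"
proof -
  interpret J: disclosure_antiderivative "joint_law 0" fst snd "\<lambda>t. g (t - 0)" "\<lambda>x. K (x - 0)"
    by (rule disclosure_antiderivative_joint) (use X_mean_positive in simp)
  have eff: "J.low.total_effect l u = low.total_effect l u"
    by (subst J.low.total_effect_def, subst J.low.loss_def, subst low.total_effect_def, subst low.loss_def)
       (simp add: cdf_snd_joint expectation_snd_joint)
  have "J.expectation snd < l" using assms by (simp add: expectation_snd_joint)
  from J.total_effect_low[OF this assms(2)] obtain r b d where "0 < r" "r < J.expectation fst" "b \<in> {0<..<1}"
    "(elaborateness (joint_law 0) fst snd r b has_real_derivative d) (at 0 within {0..<1})"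
    "sgn d = sgn (low.total_effect l u)"
    unfolding eff by blast
  moreover have "0 \<in> {0..<1 :: real}" by simp
  ultimately show ?thesis
    unfolding q_effect_possible_def using J.disclosure_model_axioms by blast
qed

text \<open>Here \<open>l + u\<close> must be negative for the target to be positive; translating \<open>X\<close> achieves this
  without changing \<open>total_effect\<close>.\<close>

lemma q_effect_possible_high:
  assumes "- expectation X < l" "l < u"
  shows "q_effect_possible (>) (sgn (high.total_effect l u))"
proof -
  define c where "c = \<bar>l\<bar> + \<bar>u\<bar> + 1"
  have c: "0 < c" "(l - c) + (u - c) < 0" by (auto simp: c_def)
  interpret J: disclosure_antiderivative "joint_law c" fst snd "\<lambda>t. g (t - c)" "\<lambda>x. K (x - c)"
    by (rule disclosure_antiderivative_joint) (use X_mean_positive c in simp)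
  \<comment> \<open>Translating \<open>X\<close> by \<open>c\<close> shifts the reflected mean and
    the reflected cdf by \<open>- c\<close>, so the shifted pair sees the same values.\<close>
  have eff: "J.high.total_effect (l - c) (u - c) = high.total_effect l u"
    by (subst J.high.total_effect_def, subst J.high.loss_def, subst high.total_effect_def, subst high.loss_def)
       (simp add: cdf_snd_joint expectation_snd_joint)
  have "- J.expectation snd < l - c" "l - c < u - c"
    using assms by (auto simp: expectation_snd_joint)
  from J.total_effect_high[OF this c(2)] obtain r b d where rbd: "J.expectation fst < r" "b \<in> {0<..<1}"
    "(elaborateness (joint_law c) fst snd r b has_real_derivative d) (at 0 within {0..<1})"
    "sgn d = sgn (high.total_effect l u)"
    unfolding eff by blast
  moreover have "0 < r" using rbd(1) J.R_mean_positive by simp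
  moreover have "0 \<in> {0..<1 :: real}" by simp
  ultimately show ?thesis
    unfolding q_effect_possible_def using J.disclosure_model_axioms by blast
qed

text \<open>The positive signs use continuity of the density at the mean, the negative ones a finite
  limit at infinity: 1 for \<open>F\<close> and 0 for \<open>- F (- x)\<close>.\<close>

lemma q_effect_ambiguous:
  "q_effect_possible (<) 1" "q_effect_possible (<) (- 1)"
  "q_effect_possible (>) 1" "q_effect_possible (>) (- 1)"
proof -
  have g: "isCont g x" for x
    using g_continuous by (simp add: continuous_on_eq_continuous_at)
  have "isCont (\<lambda>x. g (- x)) (- expectation X)"
    by (intro isCont_o2[OF _ g] continuous_intros)
  then show "q_effect_possible (>) 1"
    using high.total_effect_positive q_effect_possible_high by metis
  show "q_effect_possible (<) 1"
    using low.total_effect_positive[OF g] q_effect_possible_low by metis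
  have "(F \<longlongrightarrow> 1) at_top" by (rule X.cdf_lim_at_top_prob)
  then show "q_effect_possible (<) (- 1)"
    using low.total_effect_negative q_effect_possible_low by metis
  have "((\<lambda>x. - F (- x)) \<longlongrightarrow> - 0) at_top"
    by (intro tendsto_minus filterlim_compose[OF X.cdf_lim_at_bot] filterlim_uminus_at_bot_at_top)
  then show "q_effect_possible (>) (- 1)"
    using high.total_effect_negative q_effect_possible_high by metis
qed

end

theorem proposition3:
  fixes M :: "'a measure" and R X :: "'a \<Rightarrow> real" and g :: "real \<Rightarrow> real"
    and r \<beta> q :: real
  assumes model: "disclosure_model M R X g"
    and r: "0 < r"
    and \<beta>: "\<beta> \<in> {0<..<1}"
    and q: "q \<in> {0..<1}"
  defines "r0 \<equiv> integral\<^sup>L M R"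
  shows
    \<comment> \<open>competence\<close>
    "(r \<noteq> r0 \<longrightarrow>
        (\<exists>D<0. ((\<lambda>b. upper_threshold M R X r b q) has_real_derivative D) (at \<beta>)) \<and>
        (\<exists>D>0. ((\<lambda>b. lower_threshold M R X r b q) has_real_derivative D) (at \<beta>)) \<and>
        strict_mono_on {0<..<1} (\<lambda>b. elaborateness M R X r b q))
     \<and>
     \<comment> \<open>information environment\<close>
     (r < r0 \<longrightarrow>
        (\<exists>D<0. ((\<lambda>p. upper_threshold M R X r \<beta> p) has_real_derivative D) (at q within {0..<1})) \<and>
        (\<exists>D<0. ((\<lambda>p. lower_threshold M R X r \<beta> p) has_real_derivative D) (at q within {0..<1})) \<and>
        strict_antimono_on {0..<1} (\<lambda>p. negative_frequency M R X r \<beta> p) \<and>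
        strict_mono_on {0..<1} (\<lambda>p. positive_frequency M R X r \<beta> p))
     \<and>
     (r0 < r \<longrightarrow>
        (\<exists>D>0. ((\<lambda>p. upper_threshold M R X r \<beta> p) has_real_derivative D) (at q within {0..<1})) \<and>
        (\<exists>D>0. ((\<lambda>p. lower_threshold M R X r \<beta> p) has_real_derivative D) (at q within {0..<1})) \<and>
        strict_antimono_on {0..<1} (\<lambda>p. positive_frequency M R X r \<beta> p) \<and>
        strict_mono_on {0..<1} (\<lambda>p. negative_frequency M R X r \<beta> p))
     \<and>
     \<comment> \<open>the sign of the total effect is undetermined in either regime\<close>
     (q_effect_possible (<) 1 \<and> q_effect_possible (<) (-1) \<and>
      q_effect_possible (>) 1 \<and> q_effect_possible (>) (-1))"
proof -
  interpret disclosure_model M R X g by (rule model)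
  obtain K where "\<And>x. (K has_real_derivative F x) (at x)" using cdf_antiderivative by blast
  then interpret disclosure_antiderivative M R X g K by unfold_locales
  show ?thesis
  proof (intro conjI impI)
    assume "r \<noteq> r0"
    then consider "r < expectation R" | "expectation R < r" unfolding r0_def by linarith
    note cases = this
    show "\<exists>D<0. ((\<lambda>b. upper_threshold M R X r b q) has_real_derivative D) (at \<beta>)"
      using competence_effect_low(2)[OF r _ \<beta> q] competence_effect_high(2)[OF _ \<beta> q] by (rule cases)
    show "\<exists>D>0. ((\<lambda>b. lower_threshold M R X r b q) has_real_derivative D) (at \<beta>)"
      using competence_effect_low(1)[OF r _ \<beta> q] competence_effect_high(1)[OF _ \<beta> q] by (rule cases)
    show "strict_mono_on {0<..<1} (\<lambda>b. elaborateness M R X r b q)"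
      using elaborateness_strict_mono_low[OF r _ q] elaborateness_strict_mono_high[OF _ q] by (rule cases)
  qed (simp_all only: r0_def environment_effect_low[OF r _ \<beta> q] environment_effect_high[OF _ \<beta> q]
      frequency_low[OF r _ \<beta>] frequency_high[OF _ \<beta>] q_effect_ambiguous)
qed

end
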